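(* Let $p$ and $q$ be distinct primes with $\{p,q\}=\{2,3\}$, let $k\geq 1$ be an integer, and let $G$ be the finite group $C_q \oplus \underbrace{C_p \oplus C_p \oplus \cdots \oplus C_p}_{k \text{ copies}}$. Then the proper power graph $P^\ast(G)$ is planar.
   Context: $C_n$ denotes the cyclic group of order $n$. The power graph $P(G)$ of a group $G$ is the simple undirected graph with vertex set $G$ in which two distinct vertices $a,b$ are adjacent if and only if $a\in\langle b\rangle$ or $b\in\langle a\rangle$. The proper power graph $P^\ast(G)$ is the graph obtained from $P(G)$ by deleting the vertex corresponding to the identity element. A graph is planar if it can be drawn in the plane with no edges crossing; equivalently (Kuratowski), if it contains no subgraph that is a subdivision of $K_5$ or $K_{3,3}$. *)

theory Defs
  imports "HOL-Algebra.Product_Groups" "HOL-Analysis.Analysis"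
begin

text \<open>A simple undirected graph is a pair of a vertex set and a set of edges, each edge being
  a two-element set of vertices.\<close>

type_synonym 'v simple_graph = "'v set \<times> 'v set set"

definition power_graph :: "('a, 'b) monoid_scheme \<Rightarrow> 'a simple_graph" where
  "power_graph G =
    (carrier G,
     {{a, b} |a b. a \<in> carrier G \<and> b \<in> carrier G \<and> a \<noteq> b \<and>
        (a \<in> generate G {b} \<or> b \<in> generate G {a})})"

definition delete_vertex :: "'v simple_graph \<Rightarrow> 'v \<Rightarrow> 'v simple_graph" where
  "delete_vertex \<Gamma> v = (fst \<Gamma> - {v}, {e \<in> snd \<Gamma>. v \<notin> e})"

definition proper_power_graph :: "('a, 'b) monoid_scheme \<Rightarrow> 'a simple_graph" where
  "proper_power_graph G = delete_vertex (power_graph G) \<one>\<^bsub>G\<^esub>"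

text \<open>In a drawing, \<open>\<phi>\<close> places the vertices at distinct points of the plane (identified with
  the complex numbers), and \<open>\<gamma>\<close> draws every edge as a simple arc between the points of its two
  ends. An arc passes through no vertex other than its ends, and two different arcs meet only
  in points of common ends. The orientation of the arc \<open>\<gamma> e\<close> is arbitrary.\<close>

definition plane_drawing ::
  "'v simple_graph \<Rightarrow> ('v \<Rightarrow> complex) \<Rightarrow> ('v set \<Rightarrow> real \<Rightarrow> complex) \<Rightarrow> bool" where
  "plane_drawing \<Gamma> \<phi> \<gamma> \<longleftrightarrow>
     inj_on \<phi> (fst \<Gamma>) \<and>
     (\<forall>e \<in> snd \<Gamma>. arc (\<gamma> e) \<and> {pathstart (\<gamma> e), pathfinish (\<gamma> e)} = \<phi> ` e) \<and>
     (\<forall>e \<in> snd \<Gamma>. \<forall>v \<in> fst \<Gamma>. \<phi> v \<in> path_image (\<gamma> e) \<longrightarrow> v \<in> e) \<and>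
     (\<forall>e \<in> snd \<Gamma>. \<forall>f \<in> snd \<Gamma>. e \<noteq> f \<longrightarrow>
        path_image (\<gamma> e) \<inter> path_image (\<gamma> f) \<subseteq> \<phi> ` (e \<inter> f))"

definition planar :: "'v simple_graph \<Rightarrow> bool" where
  "planar \<Gamma> \<longleftrightarrow> (\<exists>\<phi> \<gamma>. plane_drawing \<Gamma> \<phi> \<gamma>)"

end

theory Submission
  imports Defs "HOL-Algebra.Multiplicative_Group"
begin

text \<open>Every element is the product of its cube and its fourth power, which lie in the Sylow 2- and
  3-subgroup. One of these two subgroups is cyclic, so the classes of the other one index blocks
  that meet only in the few vertices lying in the cyclic factor. If \<open>p = 3\<close>, a block is a \<open>K\<^sub>4\<close>,
  two vertices of which are joined to the unique involution. If \<open>p = 2\<close>, a block is a triangle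
  \<open>ABC\<close>, and \<open>A\<close> and \<open>B\<close> are joined to the two adjacent vertices of order 3. Both graphs embed in
  one graph: two adjacent poles and infinitely many copies of \<open>K\<^sub>4\<close>, each with two vertices joined
  to both poles. Placing the poles on the imaginary axis and stretching one straight-line drawing
  of a block horizontally by the factors \<open>3 ^ i\<close> gives a plane drawing of this graph.\<close>

section \<open>Straight-line plane graphs\<close>

text \<open>There is no separate vertex set: the vertices are the ends of the edges, and the hull of
  an edge is its segment. \<open>E\<close> may be infinite.\<close>

definition straight_line_graph :: "complex set set \<Rightarrow> bool" where
  "straight_line_graph E \<longleftrightarrow>
     (\<forall>e\<in>E. \<exists>a b. a \<noteq> b \<and> e = {a, b}) \<and>
     (\<forall>e\<in>E. \<forall>f\<in>E. e \<noteq> f \<longrightarrow> convex hull e \<inter> convex hull f \<subseteq> e \<inter> f)"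

lemma straight_line_graph_pair: "straight_line_graph E \<Longrightarrow> e \<in> E \<Longrightarrow> \<exists>a b. a \<noteq> b \<and> e = {a, b}"
  by (simp add: straight_line_graph_def)

lemma straight_line_graph_meet:
  "straight_line_graph E \<Longrightarrow> e \<in> E \<Longrightarrow> f \<in> E \<Longrightarrow> e \<noteq> f \<Longrightarrow> convex hull e \<inter> convex hull f \<subseteq> e \<inter> f"
  by (simp add: straight_line_graph_def)

text \<open>A vertex is an end of some edge, so the condition on pairs of edges already keeps it out
  of the interior of every other edge.\<close>

lemma straight_line_graph_vertex:
  assumes "straight_line_graph E" "e \<in> E" "v \<in> \<Union>E" "v \<in> convex hull e"
  shows "v \<in> e"
proof -
  obtain f where f: "f \<in> E" "v \<in> f"
    using assms(3) by blast
  then have "v \<in> convex hull f"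
    by (simp add: hull_inc)
  with f assms show ?thesis
    unfolding straight_line_graph_def by blast
qed

text \<open>Each edge is drawn as the segment between the images of its ends. Injectivity of
  \<open>h\<close> keeps distinct edges distinct and makes \<open>h\<close> commute with their
  intersection.\<close>

lemma planar_straight_line_embedding:
  assumes E: "straight_line_graph E"
    and inj: "inj_on h V" and V: "h ` V \<subseteq> \<Union>E"
    and F: "\<And>e. e \<in> F \<Longrightarrow> e \<subseteq> V \<and> h ` e \<in> E"
  shows "planar (V, F)"
proof -
  have "\<forall>e\<in>E. \<exists>p. fst p \<noteq> snd p \<and> e = {fst p, snd p}"
    using E unfolding straight_line_graph_def by simp
  \<comment> \<open>\<open>p\<close> orients every segment, since \<open>linepath\<close> needs a
    start and an end.\<close>
  then obtain p where p: "\<And>e. e \<in> E \<Longrightarrow> fst (p e) \<noteq> snd (p e) \<and> e = {fst (p e), snd (p e)}"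
    by metis
  define \<gamma> where "\<gamma> e = linepath (fst (p (h ` e))) (snd (p (h ` e)))" for e
  have img: "path_image (\<gamma> e) = convex hull (h ` e)" if "e \<in> F" for e
    using p[of "h ` e"] F[OF that] unfolding \<gamma>_def by (metis path_image_linepath segment_convex_hull)
  have "plane_drawing (V, F) h \<gamma>"
    unfolding plane_drawing_def fst_conv snd_conv
  proof (intro conjI ballI impI)
    show "inj_on h V" by (rule inj)
  next
    fix e assume "e \<in> F"
    then show "arc (\<gamma> e)" "{pathstart (\<gamma> e), pathfinish (\<gamma> e)} = h ` e"
      using p[of "h ` e"] F[of e] by (simp_all add: \<gamma>_def)
  next
    fix e v assume *: "e \<in> F" "v \<in> V" "h v \<in> path_image (\<gamma> e)"
    then have "h v \<in> h ` e"
      using straight_line_graph_vertex[OF E, of "h ` e" "h v"] F[of e] img[of e] V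
      by (metis UnionI hull_inc imageI subset_iff)
    then show "v \<in> e"
      using F[OF *(1)] *(2) inj by (auto dest: inj_onD)
  next
    fix e f assume *: "e \<in> F" "f \<in> F" "e \<noteq> f"
    then have "h ` e \<noteq> h ` f"
      using F inj by (metis inj_on_image_eq_iff)
    then have "convex hull (h ` e) \<inter> convex hull (h ` f) \<subseteq> h ` e \<inter> h ` f"
      using straight_line_graph_meet[OF E] F * by simp
    also have "\<dots> = h ` (e \<inter> f)"
      using F * inj by (metis inj_on_image_Int)
    finally show "path_image (\<gamma> e) \<inter> path_image (\<gamma> f) \<subseteq> h ` (e \<inter> f)"
      using * by (simp add: img)
  qed
  then show ?thesis
    unfolding planar_def by blast
qed

section \<open>The block and its stretched copies\<close>

text \<open>\<open>pt_C\<close> lies inside the triangle \<open>pole_N\<close>, \<open>pt_A\<close>,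
  \<open>pt_B\<close>, and \<open>pt_D\<close> inside the triangle \<open>pt_A\<close>,
  \<open>pt_B\<close>, \<open>pt_C\<close>. The two vertices on the real axis are the ones joined to
  both poles.\<close>

definition "pole_S = Complex 0 (-9)"
definition "pole_N = Complex 0 9"
definition "pt_A = Complex 9 0"
definition "pt_B = Complex 18 0"
definition "pt_C = Complex 9 3"
definition "pt_D = Complex 12 1"

lemmas pt_defs = pole_S_def pole_N_def pt_A_def pt_B_def pt_C_def pt_D_def

text \<open>The edge between the poles is left out because all copies share it;
  \<open>block_graph\<close> adds it once.\<close>

definition block :: "complex set set" where
  "block = {{pt_A, pt_B}, {pt_A, pt_C}, {pt_A, pt_D}, {pt_B, pt_C}, {pt_B, pt_D}, {pt_C, pt_D},
     {pole_S, pt_A}, {pole_S, pt_B}, {pole_N, pt_A}, {pole_N, pt_B}}"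

text \<open>The imaginary axis is fixed pointwise, so all copies have the same poles.\<close>

definition stretch :: "nat \<Rightarrow> complex \<Rightarrow> complex" where
  "stretch i z = Complex (3 ^ i * Re z) (Im z)"

text \<open>With one copy for every natural number, an injection of a finite group into
  \<open>nat\<close> can index its blocks.\<close>

definition block_graph :: "complex set set" where
  "block_graph = insert {pole_S, pole_N} (\<Union>i. (`) (stretch i) ` block)"

text \<open>For concrete end points the hypotheses become linear in \<open>x\<close>,
  \<open>y\<close>, \<open>u\<close>, \<open>v\<close>, so that linear arithmetic can decide where
  two segments meet.\<close>

lemma segments_meet_onlyI:
  assumes "\<And>x y u v. \<lbrakk>0 \<le> u; u \<le> 1; 0 \<le> v; v \<le> 1;
      x = Re a + u * (Re b - Re a); y = Im a + u * (Im b - Im a);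
      x = Re c + v * (Re d - Re c); y = Im c + v * (Im d - Im c)\<rbrakk>
    \<Longrightarrow> Complex x y \<in> {a, b} \<and> Complex x y \<in> {c, d}"
  shows "convex hull {a, b} \<inter> convex hull {c, d} \<subseteq> {a, b} \<inter> {c, d}"
proof
  fix z assume "z \<in> convex hull {a, b} \<inter> convex hull {c, d}"
  then obtain u v where uv: "0 \<le> u" "u \<le> 1" "0 \<le> v" "v \<le> 1"
    and z: "z = (1 - u) *\<^sub>R a + u *\<^sub>R b" "z = (1 - v) *\<^sub>R c + v *\<^sub>R d"
    unfolding segment_convex_hull[symmetric] closed_segment_def by auto
  have "Complex (Re z) (Im z) \<in> {a, b} \<and> Complex (Re z) (Im z) \<in> {c, d}"
    using arg_cong[OF z(1), of Re] arg_cong[OF z(1), of Im]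
      arg_cong[OF z(2), of Re] arg_cong[OF z(2), of Im]
    by (intro assms[OF uv]) (simp_all add: algebra_simps)
  then show "z \<in> {a, b} \<inter> {c, d}"
    by simp
qed

lemma straight_line_graph_empty: "straight_line_graph {}"
  by (simp add: straight_line_graph_def)

lemma straight_line_graph_insert:
  assumes "straight_line_graph E" "a \<noteq> b"
    and "\<forall>f\<in>E. convex hull {a, b} \<inter> convex hull f \<subseteq> {a, b} \<inter> f"
  shows "straight_line_graph (insert {a, b} E)"
  using assms unfolding straight_line_graph_def
  by (smt (verit, best) Int_commute insert_iff)

text \<open>Inserting the ten edges one at a time leaves 45 pairs of segments, each a problem of
  linear arithmetic.\<close>

lemma straight_line_block: "straight_line_graph block"
  unfolding block_def
  by (intro straight_line_graph_insert straight_line_graph_empty;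
      (simp only: ball_simps; intro conjI TrueI)?)
    ((rule segments_meet_onlyI; simp add: pt_defs; (linarith | smt (verit, best)))
      | (simp add: pt_defs; fail))+

text \<open>The block lies between two rhombi with common vertices at the poles, the outer one being the
  inner one stretched by 2; stretching by 3 therefore separates consecutive blocks.\<close>

lemma block_region:
  assumes "e \<in> block" "z \<in> convex hull e"
  shows "\<bar>Im z\<bar> \<le> 9" "9 - \<bar>Im z\<bar> \<le> Re z" "Re z \<le> 2 * (9 - \<bar>Im z\<bar>)"
proof -
  obtain a b where e: "e = {a, b}" and ab: "{a, b} \<in> block"
    using straight_line_graph_pair[OF straight_line_block assms(1)] assms(1) by blast
  obtain u where u: "0 \<le> u" "u \<le> 1" and z: "z = (1 - u) *\<^sub>R a + u *\<^sub>R b"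
    using assms(2) unfolding e segment_convex_hull[symmetric] closed_segment_def by auto
  \<comment> \<open>The region is not convex, but no edge crosses the real axis, and on either side
    of it the conditions are linear.\<close>
  have "\<bar>Im z\<bar> \<le> 9 \<and> 9 - \<bar>Im z\<bar> \<le> Re z \<and> Re z \<le> 2 * (9 - \<bar>Im z\<bar>)"
    using ab u unfolding block_def z
    by (elim insertE emptyE; auto simp: doubleton_eq_iff pt_defs abs_if algebra_simps)
  then show "\<bar>Im z\<bar> \<le> 9" "9 - \<bar>Im z\<bar> \<le> Re z" "Re z \<le> 2 * (9 - \<bar>Im z\<bar>)"
    by auto
qed

lemma linear_stretch: "linear (stretch i)"
  by (rule linearI) (simp_all add: stretch_def complex_eq_iff algebra_simps)

lemma inj_stretch: "inj (stretch i)"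
  by (rule injI) (simp add: stretch_def complex_eq_iff)

lemma stretch_pole [simp]: "stretch i pole_S = pole_S" "stretch i pole_N = pole_N"
  by (simp_all add: stretch_def pt_defs)

lemma convex_hull_stretch: "convex hull (stretch i ` e) = stretch i ` (convex hull e)"
  by (rule convex_hull_linear_image[OF linear_stretch, symmetric])

text \<open>A pole is fixed by the injective map \<open>stretch i\<close>, so \<open>z\<close> is
  that pole itself, which is a vertex of the block.\<close>

lemma pole_mem_blockD:
  assumes e: "e \<in> block" and z: "stretch i z \<in> {pole_S, pole_N}" "z \<in> convex hull e"
  shows "z \<in> e"
proof -
  have "z \<in> {pole_S, pole_N}"
    using z(1) inj_stretch[of i] stretch_pole[of i] by (metis injD insert_iff empty_iff)
  moreover have "pole_S \<in> \<Union>block" "pole_N \<in> \<Union>block"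
    unfolding block_def by auto
  ultimately show ?thesis
    using straight_line_graph_vertex[OF straight_line_block e _ z(2)] by auto
qed

text \<open>At the height of \<open>z\<close>, with \<open>d = 9 - \<bar>Im z\<bar>\<close>, copy
  \<open>i\<close> ends at the latest at \<open>2 * 3 ^ i * d\<close>, while copy \<open>j\<close>
  begins no earlier than \<open>3 * 3 ^ i * d\<close>. A common point forces \<open>d = 0\<close>,
  which is a pole.\<close>

lemma stretched_blocks_meet:
  assumes e: "e \<in> block" and f: "f \<in> block" and "i < j"
    and z: "z \<in> convex hull (stretch i ` e)" "z \<in> convex hull (stretch j ` f)"
  shows "z \<in> {pole_S, pole_N}"
proof -
  obtain x y where x: "x \<in> convex hull e" "z = stretch i x" and y: "y \<in> convex hull f" "z = stretch j y"
    using z unfolding convex_hull_stretch by blast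
  define d where "d = 9 - \<bar>Im z\<bar>"
  have z_eq: "Im x = Im z" "Im y = Im z" "Re z = 3 ^ i * Re x" "Re z = 3 ^ j * Re y"
    using x(2) y(2) by (metis complex.sel stretch_def)+
  have xy: "d \<ge> 0" "d \<le> Re x" "Re x \<le> 2 * d" "d \<le> Re y"
    using block_region[OF e x(1)] block_region[OF f y(1)] unfolding d_def z_eq by simp_all
  have d: "d \<ge> 0" "3 ^ i * d \<le> Re z" "Re z \<le> 3 ^ i * (2 * d)"
    unfolding z_eq(3) using xy by (auto intro: mult_left_mono)
  have Re_z: "3 ^ j * d \<le> Re z"
    unfolding z_eq(4) using xy by (auto intro: mult_left_mono)
  have "(3::real) ^ Suc i \<le> 3 ^ j"
    using \<open>i < j\<close> by (intro power_increasing) auto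
  then have "3 * (3 ^ i * d) \<le> 3 ^ j * d"
    using mult_right_mono[OF _ d(1)] by fastforce
  with d(3) Re_z have "3 ^ i * d \<le> 0"
    by simp
  with d(1) have "d = 0"
    by (simp add: mult_le_0_iff) (use zero_less_power[of "3::real" i] in linarith)
  with d(2,3) show ?thesis
    unfolding d_def by (auto simp: pt_defs complex_eq_iff)
qed

text \<open>Within one copy the property is carried over by an injective linear map. Different
  copies meet only in poles, and so do a copy and the segment between the poles; a pole on an edge
  is an end of it.\<close>

lemma straight_line_block_graph: "straight_line_graph block_graph"
proof -
  define E where "E = (\<Union>i. (`) (stretch i) ` block)"
  have pair: "\<exists>a b. a \<noteq> b \<and> e = {a, b}" if eE: "e \<in> E" for e
  proof -
    obtain i e0 where e: "e = stretch i ` e0" "e0 \<in> block"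
      using eE unfolding E_def by blast
    obtain a b where "a \<noteq> b" "e0 = {a, b}"
      using straight_line_graph_pair[OF straight_line_block e(2)] by blast
    then have "stretch i a \<noteq> stretch i b" "e = {stretch i a, stretch i b}"
      using e by (simp_all add: inj_eq[OF inj_stretch])
    then show ?thesis by blast
  qed
  have pole: "z \<in> e" if pole: "e \<in> E" "z \<in> convex hull e" "z \<in> {pole_S, pole_N}" for e z
  proof -
    obtain i e0 where e: "e = stretch i ` e0" "e0 \<in> block"
      using pole(1) unfolding E_def by blast
    then obtain y where "z = stretch i y" "y \<in> convex hull e0"
      using pole(2) by (auto simp: convex_hull_stretch)
    then show ?thesis
      using pole_mem_blockD[OF e(2)] pole(3) e(1) by blast
  qed
  have meet: "convex hull e \<inter> convex hull f \<subseteq> e \<inter> f" if ef: "e \<in> E" "f \<in> E" "e \<noteq> f" for e f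
  proof
    fix z assume z: "z \<in> convex hull e \<inter> convex hull f"
    obtain i e0 where e: "e = stretch i ` e0" "e0 \<in> block"
      using ef(1) unfolding E_def by blast
    obtain j f0 where f: "f = stretch j ` f0" "f0 \<in> block"
      using ef(2) unfolding E_def by blast
    show "z \<in> e \<inter> f"
    proof (cases "i = j")
      case True
      then have "convex hull e0 \<inter> convex hull f0 \<subseteq> e0 \<inter> f0"
        using straight_line_graph_meet[OF straight_line_block e(2) f(2)] e f ef by blast
      then show ?thesis
        using z unfolding e f True convex_hull_stretch image_Int[OF inj_stretch, symmetric]
        by blast
    next
      case False
      then have "z \<in> {pole_S, pole_N}"
        using z e f stretched_blocks_meet by (metis IntD1 IntD2 nat_neq_iff)
      then show ?thesis
        using pole[OF ef(1)] pole[OF ef(2)] z by blast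
    qed
  qed
  have axis: "convex hull {pole_S, pole_N} \<inter> convex hull e \<subseteq> {pole_S, pole_N} \<inter> e"
    if eE: "e \<in> E" for e
  proof
    fix z assume z: "z \<in> convex hull {pole_S, pole_N} \<inter> convex hull e"
    then have "Re z = 0"
      unfolding segment_convex_hull[symmetric] closed_segment_def by (auto simp: pt_defs)
    moreover obtain i e0 y where "e0 \<in> block" "y \<in> convex hull e0" "z = stretch i y"
      using z eE unfolding E_def by (auto simp: convex_hull_stretch)
    \<comment> \<open>\<open>Re y = 0\<close> puts \<open>y\<close> on the inner rhombus only if
      \<open>\<bar>Im y\<bar> = 9\<close>.\<close>
    ultimately have "z \<in> {pole_S, pole_N}"
      using block_region[of e0 y] by (auto simp: stretch_def pt_defs complex_eq_iff)
    then show "z \<in> {pole_S, pole_N} \<inter> e"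
      using pole[OF eE] z by blast
  qed
  have "straight_line_graph E"
    unfolding straight_line_graph_def using pair meet by simp
  moreover have "pole_S \<noteq> pole_N"
    by (simp add: pt_defs)
  ultimately show ?thesis
    unfolding block_graph_def E_def[symmetric] using axis by (simp add: straight_line_graph_insert)
qed

section \<open>Vertices and edges of the block graph\<close>

text \<open>These are the vertices of a block that are not shared between copies.\<close>

definition "corners = {pt_A, pt_B, pt_C, pt_D}"

lemma stretch_neq_pole: "p \<in> corners \<Longrightarrow> stretch i p \<noteq> pole_S \<and> stretch i p \<noteq> pole_N"
  by (auto simp: corners_def stretch_def pt_defs)

text \<open>Different copies share only the poles, and no stretched corner is a pole; within one
  copy \<open>stretch i\<close> is injective.\<close>

lemma stretch_eq_iff:
  assumes "p \<in> corners" "q \<in> corners"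
  shows "stretch i p = stretch j q \<longleftrightarrow> i = j \<and> p = q"
proof -
  have "i = j" if eq: "stretch i p = stretch j q"
  proof (rule ccontr)
    assume "i \<noteq> j"
    \<comment> \<open>Each corner is viewed as an end of an edge, so that the result on hulls of
      edges applies to it.\<close>
    obtain e f where "e \<in> block" "f \<in> block" "p \<in> e" "q \<in> f"
      using assms unfolding corners_def block_def by blast
    then have "stretch i p \<in> convex hull (stretch i ` e)" "stretch j q \<in> convex hull (stretch j ` f)"
      by (simp_all add: hull_inc)
    then have "stretch i p \<in> convex hull (stretch i ` e)" "stretch i p \<in> convex hull (stretch j ` f)"
      by (simp_all add: eq)
    then have "stretch i p \<in> {pole_S, pole_N}"
      using stretched_blocks_meet \<open>i \<noteq> j\<close> \<open>e \<in> block\<close> \<open>f \<in> block\<close> by (metis nat_neq_iff)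
    then show False
      using stretch_neq_pole[OF assms(1)] by blast
  qed
  then show ?thesis
    using injD[OF inj_stretch] by metis
qed

lemma block_graph_corners:
  assumes "p \<in> corners" "q \<in> corners" "p \<noteq> q"
  shows "{stretch i p, stretch i q} \<in> block_graph"
proof -
  have "{p, q} \<in> block"
    using assms unfolding corners_def block_def
    by (elim insertE emptyE) (simp_all add: doubleton_eq_iff)
  then have "stretch i ` {p, q} \<in> block_graph"
    unfolding block_graph_def by blast
  then show ?thesis by simp
qed

lemma block_graph_pole:
  assumes "p \<in> {pole_S, pole_N}" "q \<in> {pt_A, pt_B}"
  shows "{p, stretch i q} \<in> block_graph"
proof -
  have "{p, q} \<in> block"
    using assms unfolding block_def
    by (elim insertE emptyE) (simp_all add: doubleton_eq_iff)
  then have "stretch i ` {p, q} \<in> block_graph"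
    unfolding block_graph_def by blast
  with assms(1) show ?thesis by auto
qed

lemma block_graph_vertices:
  "pole_S \<in> \<Union>block_graph" "pole_N \<in> \<Union>block_graph"
  "p \<in> corners \<Longrightarrow> stretch i p \<in> \<Union>block_graph"
proof -
  show "pole_S \<in> \<Union>block_graph" "pole_N \<in> \<Union>block_graph"
    unfolding block_graph_def by simp_all
  assume "p \<in> corners"
  then have "\<exists>q \<in> corners. p \<noteq> q"
    by (auto simp: corners_def pt_defs)
  with \<open>p \<in> corners\<close> show "stretch i p \<in> \<Union>block_graph"
    using block_graph_corners by blast
qed

section \<open>From power graphs to the block graph\<close>

text \<open>Edges are unordered, so it suffices to treat the case that \<open>b\<close> generates
  \<open>a\<close>.\<close>

lemma planar_proper_power_graphI:
  assumes inj: "inj_on h (carrier G - {\<one>\<^bsub>G\<^esub>})"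
    and vert: "\<And>a. a \<in> carrier G \<Longrightarrow> a \<noteq> \<one>\<^bsub>G\<^esub> \<Longrightarrow> h a \<in> \<Union>block_graph"
    and edge: "\<And>a b. \<lbrakk>a \<in> carrier G; b \<in> carrier G; a \<noteq> \<one>\<^bsub>G\<^esub>; b \<noteq> \<one>\<^bsub>G\<^esub>; a \<noteq> b;
      a \<in> generate G {b}\<rbrakk> \<Longrightarrow> {h a, h b} \<in> block_graph"
  shows "planar (proper_power_graph G)"
proof -
  have "e \<subseteq> carrier G - {\<one>\<^bsub>G\<^esub>} \<and> h ` e \<in> block_graph"
    if e: "e \<in> {e \<in> snd (power_graph G). \<one>\<^bsub>G\<^esub> \<notin> e}" for e
  proof -
    obtain a b where ab: "e = {a, b}" "a \<in> carrier G" "b \<in> carrier G" "a \<noteq> b"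
      "a \<in> generate G {b} \<or> b \<in> generate G {a}" "a \<noteq> \<one>\<^bsub>G\<^esub>" "b \<noteq> \<one>\<^bsub>G\<^esub>"
      using e unfolding power_graph_def by auto
    then have "{h a, h b} \<in> block_graph"
      using edge[of a b] edge[of b a] by (metis insert_commute)
    with ab show ?thesis by simp
  qed
  moreover have "h ` (carrier G - {\<one>\<^bsub>G\<^esub>}) \<subseteq> \<Union>block_graph"
    using vert by blast
  ultimately have "planar (carrier G - {\<one>\<^bsub>G\<^esub>}, {e \<in> snd (power_graph G). \<one>\<^bsub>G\<^esub> \<notin> e})"
    using planar_straight_line_embedding[OF straight_line_block_graph inj] by blast
  then show ?thesis
    by (simp add: proper_power_graph_def delete_vertex_def power_graph_def)
qed

section \<open>Abelian groups of exponent dividing 6\<close>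

text \<open>If \<open>a = b [^] k\<close>, then \<open>a [^] 3 = (b [^] 3) [^] k\<close>, and
  likewise for 4. The orders of \<open>b [^] 3\<close> and \<open>b [^] 4\<close> divide 2 and 3, so
  only \<open>k\<close> modulo 2 and modulo 3 matters.\<close>

lemma (in comm_group) cyclic_parts:
  assumes fin: "finite (carrier G)" and exp: "\<And>x. x \<in> carrier G \<Longrightarrow> x [^] (6::nat) = \<one>"
    and b: "b \<in> carrier G" and a: "a \<in> generate G {b}"
  shows "a [^] (3::nat) \<in> {\<one>, b [^] (3::nat)}"
    and "a [^] (4::nat) \<in> {\<one>, b [^] (4::nat), b [^] (4::nat) \<otimes> b [^] (4::nat)}"
proof -
  have red: "x [^] n = x [^] (n mod m)" if x: "x \<in> carrier G" "x [^] m = \<one>" for x and m n :: nat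
  proof -
    have "x [^] n = x [^] (m * (n div m)) \<otimes> x [^] (n mod m)"
      using x by (simp add: nat_pow_mult)
    then show ?thesis
      using x by (simp flip: nat_pow_pow)
  qed
  obtain k :: nat where k: "a = b [^] k"
    using a generate_pow_on_finite_carrier[OF fin b] by auto
  have swap: "a [^] n = (b [^] n) [^] k" for n :: nat
    using b by (simp add: k nat_pow_pow mult.commute)
  have "(b [^] (3::nat)) [^] (2::nat) = \<one>"
    using b exp by (simp add: nat_pow_pow)
  from red[OF _ this, of k] b have "a [^] (3::nat) = (b [^] (3::nat)) [^] (k mod 2)"
    by (simp add: swap)
  moreover have "k mod 2 = 0 \<or> k mod 2 = 1"
    by auto
  ultimately show "a [^] (3::nat) \<in> {\<one>, b [^] (3::nat)}"
    using b by auto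
  have "(b [^] (4::nat)) [^] (3::nat) = (b [^] (6::nat)) [^] (2::nat)"
    using b by (simp add: nat_pow_pow)
  then have "(b [^] (4::nat)) [^] (3::nat) = \<one>"
    using b exp by simp
  from red[OF _ this, of k] b have "a [^] (4::nat) = (b [^] (4::nat)) [^] (k mod 3)"
    by (simp add: swap)
  moreover have "k mod 3 = 0 \<or> k mod 3 = 1 \<or> k mod 3 = 2"
    by auto
  ultimately show "a [^] (4::nat) \<in> {\<one>, b [^] (4::nat), b [^] (4::nat) \<otimes> b [^] (4::nat)}"
    using b by (auto simp: numeral_2_eq_2)
qed

text \<open>The exponents add up to 7, which is 1 modulo 6.\<close>

lemma (in group) exponent_6_decomp:
  assumes "x \<in> carrier G" "x [^] (6::nat) = \<one>"
  shows "x [^] (3::nat) \<otimes> x [^] (4::nat) = x"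
proof -
  have "x [^] (3::nat) \<otimes> x [^] (4::nat) = x [^] (6::nat) \<otimes> x [^] (1::nat)"
    using assms(1) by (simp only: nat_pow_mult) simp
  then show ?thesis
    using assms by simp
qed

text \<open>This serves \<open>p = 3\<close>, with \<open>t\<close> the involution. A block is
  formed by the four elements whose part \<open>w\<close> generates a given subgroup of order 3, and
  \<open>t\<close> goes to a pole.\<close>

lemma (in comm_group) planar_unique_involution:
  assumes fin: "finite (carrier G)" and exp: "\<And>x. x \<in> carrier G \<Longrightarrow> x [^] (6::nat) = \<one>"
    and t: "\<And>x. x \<in> carrier G \<Longrightarrow> x [^] (3::nat) \<in> {\<one>, t}"
  shows "planar (proper_power_graph G)"
proof -
  define u where "u x = x [^] (3::nat)" for x
  define w where "w x = x [^] (4::nat)" for x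
  have u: "u x \<in> {\<one>, t}" if "x \<in> carrier G" for x
    using t that by (simp add: u_def)
  have dec: "u x \<otimes> w x = x" if "x \<in> carrier G" for x
    using exponent_6_decomp[OF that exp[OF that]] by (simp add: u_def w_def)
  have eqI: "x = y" if "x \<in> carrier G" "y \<in> carrier G" "u x = u y" "w x = w y" for x y
    using that dec by metis
  have oneI: "x = \<one>" if "x \<in> carrier G" "u x = \<one>" "w x = \<one>" for x
    using dec[OF that(1)] that by simp
  have w_closed: "w x \<in> carrier G" if "x \<in> carrier G" for x
    using that by (simp add: w_def)
  \<comment> \<open>Squaring is an involution on the parts of order dividing 3, since
    \<open>x [^] 16 = x [^] 12 \<otimes> x [^] 4\<close>.\<close>
  have w4: "(w x \<otimes> w x) \<otimes> (w x \<otimes> w x) = w x" if x: "x \<in> carrier G" for x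
  proof -
    have "(w x \<otimes> w x) \<otimes> (w x \<otimes> w x) = (x [^] (6::nat)) [^] (2::nat) \<otimes> w x"
      using x unfolding w_def by (simp add: nat_pow_mult nat_pow_pow)
    then show ?thesis
      using exp x w_closed by simp
  qed
  obtain \<nu> :: "'a \<Rightarrow> nat" where \<nu>: "inj_on \<nu> (carrier G)"
    using finite_imp_inj_to_nat_seg[OF fin] by blast
  \<comment> \<open>\<open>y\<close> and \<open>y \<otimes> y\<close> generate the same subgroup of order 3; \<open>r\<close> chooses one of them.\<close>
  define r where "r y = (SOME v. v \<in> {y, y \<otimes> y})" for y
  have r: "r y \<in> {y, y \<otimes> y}" for y
    unfolding r_def by (rule someI[of _ y]) simp
  have r_closed: "r y \<in> carrier G" if "y \<in> carrier G" for y
    using r[of y] m_closed[OF that that] that by (metis insertE singletonD)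
  \<comment> \<open>By \<open>w4\<close>, \<open>w x\<close> and its square give the same
    two-element set, hence the same choice.\<close>
  have r_sq: "r (w x \<otimes> w x) = r (w x)" if "x \<in> carrier G" for x
    unfolding r_def w4[OF that] by (simp add: insert_commute)
  \<comment> \<open>The corner records whether \<open>u x\<close> is trivial and whether
    \<open>w x\<close> is the chosen generator. Elements of order 6 get \<open>pt_A\<close> and
    \<open>pt_B\<close>, because they are adjacent to \<open>t\<close>.\<close>
  define c where "c x = (if u x = \<one> then (if r (w x) = w x then pt_C else pt_D)
    else (if r (w x) = w x then pt_A else pt_B))" for x
  define h where "h x = (if w x = \<one> then pole_S else stretch (\<nu> (r (w x))) (c x))" for x
  have c: "c x \<in> corners" for x
    by (simp add: c_def corners_def)
  have inj: "inj_on h (carrier G - {\<one>})"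
  proof (rule inj_onI)
    fix x y assume x: "x \<in> carrier G - {\<one>}" and y: "y \<in> carrier G - {\<one>}" and "h x = h y"
    have "w x = \<one> \<longleftrightarrow> w y = \<one>"
      using \<open>h x = h y\<close> stretch_neq_pole[OF c] unfolding h_def by metis
    moreover have "x = y" if "w x = \<one>" "w y = \<one>"
    proof -
      have "u x = t"
        using u[of x] oneI[of x] x that by blast
      moreover have "u y = t"
        using u[of y] oneI[of y] y that by blast
      ultimately show "x = y"
        using eqI[of x y] x y that by simp
    qed
    moreover have "x = y" if "w x \<noteq> \<one>" "w y \<noteq> \<one>"
    proof -
      have "\<nu> (r (w x)) = \<nu> (r (w y))" and c_eq: "c x = c y"
        using \<open>h x = h y\<close> that stretch_eq_iff[OF c c] by (simp_all add: h_def)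
      moreover have "r (w x) \<in> carrier G" "r (w y) \<in> carrier G"
        using r_closed w_closed x y by simp_all
      ultimately have r_eq: "r (w x) = r (w y)"
        using inj_onD[OF \<nu>] by metis
      have "u x = \<one> \<longleftrightarrow> u y = \<one>" and sgn: "r (w x) = w x \<longleftrightarrow> r (w y) = w y"
        using c_eq by (simp_all add: c_def pt_defs split: if_splits)
      then have "u x = u y"
        using u[of x] u[of y] x y by (metis DiffD1 insertE singletonD)
      \<comment> \<open>If neither part is the chosen generator, their squares agree, and squaring
        once more gives back the parts by \<open>w4\<close>.\<close>
      moreover have "w x = w y"
        using r[of "w x"] r[of "w y"] r_eq sgn w4[of x] w4[of y] x y
        by (metis DiffD1 insertE singletonD)
      ultimately show "x = y"
        using eqI[of x y] x y by simp
    qed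
    ultimately show "x = y" by blast
  qed
  show ?thesis
  proof (rule planar_proper_power_graphI[OF inj])
    show "h a \<in> \<Union>block_graph" for a
      using block_graph_vertices c by (simp add: h_def)
  next
    fix a b assume ab: "a \<in> carrier G" "b \<in> carrier G" "a \<noteq> \<one>" "b \<noteq> \<one>" "a \<noteq> b"
      and gen: "a \<in> generate G {b}"
    have ua: "u a \<in> {\<one>, u b}" and wa: "w a \<in> {\<one>, w b, w b \<otimes> w b}"
      using cyclic_parts[OF fin exp ab(2) gen] by (simp_all add: u_def w_def)
    have trivial_w: "u x \<noteq> \<one>" if "x \<in> {a, b}" "w x = \<one>" for x
      using oneI[of x] that ab by auto
    show "{h a, h b} \<in> block_graph"
    proof (cases "w a = \<one>")
      case True
      \<comment> \<open>Here \<open>a\<close> is the involution, and \<open>b\<close> must have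
        order 6, so it sits at a corner joined to the poles.\<close>
      then have "u a = u b" "u b \<noteq> \<one>"
        using ua trivial_w[of a] by auto
      then have "w b \<noteq> \<one>"
        using eqI[OF ab(1,2)] ab(5) True by metis
      with True \<open>u b \<noteq> \<one>\<close> show ?thesis
        by (auto simp: h_def c_def intro!: block_graph_pole)
    next
      case False
      have wb: "w b \<noteq> \<one>"
        using False wa by auto
      \<comment> \<open>Both elements lie in the same block, where any two distinct corners are
        joined.\<close>
      have "r (w a) = r (w b)"
        using wa False r_sq[OF ab(2)] by (metis insertE singletonD)
      moreover have "h a \<noteq> h b"
        using inj ab by (auto dest: inj_onD)
      ultimately show ?thesis
        using False wb c by (auto simp: h_def intro!: block_graph_corners)
    qed
  qed
qed

text \<open>This serves \<open>p = 2\<close>, with \<open>s\<close> and \<open>s'\<close> the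
  elements of order 3, placed at the poles. The blocks are indexed by the involutions
  \<open>u x\<close>.\<close>

lemma (in comm_group) planar_unique_order_3_subgroup:
  assumes fin: "finite (carrier G)" and exp: "\<And>x. x \<in> carrier G \<Longrightarrow> x [^] (6::nat) = \<one>"
    and s: "\<And>x. x \<in> carrier G \<Longrightarrow> x [^] (4::nat) \<in> {\<one>, s, s'}"
  shows "planar (proper_power_graph G)"
proof -
  define u where "u x = x [^] (3::nat)" for x
  define w where "w x = x [^] (4::nat)" for x
  have w: "w x \<in> {\<one>, s, s'}" if "x \<in> carrier G" for x
    using s that by (simp add: w_def)
  have dec: "u x \<otimes> w x = x" if "x \<in> carrier G" for x
    using exponent_6_decomp[OF that exp[OF that]] by (simp add: u_def w_def)
  have eqI: "x = y" if "x \<in> carrier G" "y \<in> carrier G" "u x = u y" "w x = w y" for x y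
    using that dec by metis
  have oneI: "x = \<one>" if "x \<in> carrier G" "u x = \<one>" "w x = \<one>" for x
    using dec[OF that(1)] that by simp
  have u_closed: "u x \<in> carrier G" if "x \<in> carrier G" for x
    using that by (simp add: u_def)
  obtain \<nu> :: "'a \<Rightarrow> nat" where \<nu>: "inj_on \<nu> (carrier G)"
    using finite_imp_inj_to_nat_seg[OF fin] by blast
  \<comment> \<open>The involution itself goes to \<open>pt_C\<close>, away from the poles; its
    products with \<open>s\<close> and \<open>s'\<close> are adjacent to both poles.\<close>
  define c where "c x = (if w x = \<one> then pt_C else if w x = s then pt_A else pt_B)" for x
  define h where "h x = (if u x = \<one> then (if w x = s then pole_S else pole_N)
    else stretch (\<nu> (u x)) (c x))" for x
  have c: "c x \<in> corners" for x
    by (simp add: c_def corners_def)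
  have trivial_u: "w x \<noteq> \<one>" if "x \<in> carrier G" "x \<noteq> \<one>" "u x = \<one>" for x
    using oneI[of x] that by auto
  have inj: "inj_on h (carrier G - {\<one>})"
  proof (rule inj_onI)
    fix x y assume x: "x \<in> carrier G - {\<one>}" and y: "y \<in> carrier G - {\<one>}" and "h x = h y"
    have "u x = \<one> \<longleftrightarrow> u y = \<one>"
      using \<open>h x = h y\<close> stretch_neq_pole[OF c] unfolding h_def by metis
    moreover have "x = y" if "u x = \<one>" "u y = \<one>"
    proof -
      have "w x = s \<longleftrightarrow> w y = s"
        using \<open>h x = h y\<close> that by (auto simp: h_def pt_defs split: if_splits)
      then have "w x = w y"
        using w[of x] w[of y] trivial_u[of x] trivial_u[of y] x y that by auto
      then show "x = y"
        using eqI[of x y] x y that by simp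
    qed
    moreover have "x = y" if "u x \<noteq> \<one>" "u y \<noteq> \<one>"
    proof -
      have "\<nu> (u x) = \<nu> (u y)" and c_eq: "c x = c y"
        using \<open>h x = h y\<close> that stretch_eq_iff[OF c c] by (simp_all add: h_def)
      then have "u x = u y"
        using \<nu> u_closed x y by (auto dest: inj_onD)
      moreover have "w x = w y"
        using c_eq w[of x] w[of y] x y by (auto simp: c_def pt_defs split: if_splits)
      ultimately show "x = y"
        using eqI[of x y] x y by simp
    qed
    ultimately show "x = y" by blast
  qed
  show ?thesis
  proof (rule planar_proper_power_graphI[OF inj])
    show "h a \<in> \<Union>block_graph" for a
      using block_graph_vertices c by (simp add: h_def)
  next
    fix a b assume ab: "a \<in> carrier G" "b \<in> carrier G" "a \<noteq> \<one>" "b \<noteq> \<one>" "a \<noteq> b"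
      and gen: "a \<in> generate G {b}"
    have ua: "u a \<in> {\<one>, u b}" and wa: "w a \<in> {\<one>, w b, w b \<otimes> w b}"
      using cyclic_parts[OF fin exp ab(2) gen] by (simp_all add: u_def w_def)
    have neq: "h a \<noteq> h b"
      using inj ab by (auto dest: inj_onD)
    show "{h a, h b} \<in> block_graph"
    proof (cases "u a = \<one>")
      case ua1: True
      show ?thesis
      proof (cases "u b = \<one>")
        case True
        then have "{h a, h b} = {pole_S, pole_N}"
          using neq ua1 by (auto simp: h_def)
        then show ?thesis
          by (simp add: block_graph_def)
      next
        case False
        \<comment> \<open>A trivial \<open>w b\<close> would make \<open>w a\<close>, and with it
          \<open>a\<close>, trivial; hence \<open>b\<close> sits at \<open>pt_A\<close> or
          \<open>pt_B\<close>.\<close>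
        have "w b \<noteq> \<one>"
          using trivial_u[of a] ab ua1 wa by auto
        with ua1 False show ?thesis
          by (auto simp: h_def c_def intro!: block_graph_pole)
      qed
    next
      case False
      then have "u a = u b" "u b \<noteq> \<one>"
        using ua by auto
      with neq show ?thesis
        using c by (auto simp: h_def intro!: block_graph_corners)
    qed
  qed
qed

section \<open>Powers in the direct product and transfer along the isomorphism\<close>

lemma nat_pow_DirProd:
  "(x, y) [^]\<^bsub>G \<times>\<times> H\<^esub> (n::nat) = (x [^]\<^bsub>G\<^esub> n, y [^]\<^bsub>H\<^esub> n)"
  by (induction n) (simp_all add: nat_pow_def)

lemma nat_pow_product_group:
  "x [^]\<^bsub>product_group I G\<^esub> (n::nat) = (\<lambda>i\<in>I. x i [^]\<^bsub>G i\<^esub> n)"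
  by (induction n) (auto simp: nat_pow_def)

lemma comm_group_DirProd:
  assumes "comm_group G" "comm_group H"
  shows "comm_group (G \<times>\<times> H)"
proof -
  interpret G: comm_group G by fact
  interpret H: comm_group H by fact
  show ?thesis
    by (rule group.group_comm_groupI[OF DirProd_group[OF G.group_axioms H.group_axioms]])
      (auto simp: G.m_comm H.m_comm)
qed

lemma comm_group_product_group:
  assumes "\<And>i. i \<in> I \<Longrightarrow> comm_group (G i)"
  shows "comm_group (product_group I G)"
proof (rule group.group_comm_groupI)
  show "group (product_group I G)"
    using assms by (simp add: comm_group.axioms(2))
next
  fix x y assume "x \<in> carrier (product_group I G)" "y \<in> carrier (product_group I G)"
  then show "x \<otimes>\<^bsub>product_group I G\<^esub> y = y \<otimes>\<^bsub>product_group I G\<^esub> x"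
    using assms comm_groupE(4) by (fastforce intro: restrict_ext)
qed

text \<open>Moves equations between powers into the concrete product, where they are computations
  with residues.\<close>

lemma iso_pow_eq_iff:
  assumes "f \<in> iso G H" "group G" "group H" "x \<in> carrier G" "y \<in> carrier G"
  shows "x [^]\<^bsub>G\<^esub> (n::nat) = y \<longleftrightarrow> f x [^]\<^bsub>H\<^esub> n = f y"
proof -
  have "f (x [^]\<^bsub>G\<^esub> n) = f x [^]\<^bsub>H\<^esub> n"
    using assms by (intro hom_nat_pow) (auto simp: iso_def)
  moreover have "inj_on f (carrier G)"
    using assms(1) by (simp add: iso_def bij_betw_def)
  ultimately show ?thesis
    using assms by (metis inj_on_eq_iff monoid.nat_pow_closed group.is_monoid)
qed

theorem theorem4p5:
  fixes p q k :: nat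
    and G :: "('a, 'b) monoid_scheme"
  assumes "prime p" and "prime q" and "p \<noteq> q"
    and "{p, q} = {2, 3}"
    and "k \<ge> 1"
    and "group G"
    and "G \<cong> integer_mod_group q \<times>\<times> product_group {1..k} (\<lambda>_. integer_mod_group p)"
  shows "planar (proper_power_graph G)"
proof -
  define P where "P = product_group {1..k} (\<lambda>_. integer_mod_group p)"
  define H where "H = integer_mod_group q \<times>\<times> P"
  have GH: "G \<cong> H"
    using assms(7) by (simp add: H_def P_def)
  have "comm_group H"
    unfolding H_def P_def by (intro comm_group_DirProd comm_group_product_group) auto
  then interpret H: comm_group H .
  interpret G: comm_group G
    using H.iso_imp_comm_group[OF group.iso_sym[OF assms(6) GH]] assms(6) by (simp add: group.is_monoid)
  obtain f where f: "f \<in> iso G H"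
    using GH by (auto simp: is_iso_def)
  then have bij: "bij_betw f (carrier G) (carrier H)"
    by (simp add: iso_def)
  have pq: "p = 2 \<and> q = 3 \<or> p = 3 \<and> q = 2"
    using assms(4) by (auto simp: doubleton_eq_iff)
  \<comment> \<open>\<open>integer_mod_group 0\<close> would be all of the integers;
    \<open>pq\<close> makes both moduli positive.\<close>
  have carrier_H: "carrier H = {0..<int q} \<times> (\<Pi>\<^sub>E i\<in>{1..k}. {0..<int p})"
    using pq by (auto simp: H_def P_def carrier_integer_mod_group)
  have fin: "finite (carrier G)"
    using bij_betw_finite[OF bij] by (simp add: carrier_H finite_PiE)
  have pow_H: "(z, y) [^]\<^bsub>H\<^esub> n = (int n * z mod int q, \<lambda>i\<in>{1..k}. int n * y i mod int p)"
    for z y and n :: nat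
    by (simp add: H_def P_def nat_pow_DirProd nat_pow_product_group)
  have one_H: "\<one>\<^bsub>H\<^esub> = (0, \<lambda>i\<in>{1..k}. 0)"
    by (simp add: H_def P_def)
  have f_one: "f \<one>\<^bsub>G\<^esub> = \<one>\<^bsub>H\<^esub>"
    using hom_one[of f G H] f by (simp add: iso_def)
  have exp: "x [^]\<^bsub>G\<^esub> (6::nat) = \<one>\<^bsub>G\<^esub>" if "x \<in> carrier G" for x
    using pq by (cases "f x")
      (auto simp: iso_pow_eq_iff[OF f] that f_one pow_H one_H intro!: restrict_ext)
  have lift: "\<exists>g \<in> carrier G. f g = (z, \<lambda>i\<in>{1..k}. 0)" if "0 \<le> z" "z < int q" for z
  proof -
    have "(z, \<lambda>i\<in>{1..k}. 0) \<in> carrier H"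
      using that pq by (auto simp: carrier_H)
    then show ?thesis
      using bij by (metis bij_betw_def imageE)
  qed
  consider "p = 2" "q = 3" | "p = 3" "q = 2"
    using pq by blast
  then show ?thesis
  proof cases
    case 1
    \<comment> \<open>These come from the two nonzero residues of the factor of order 3. Fourth
      powers vanish in all components modulo 2, so they stay in this factor.\<close>
    obtain s s' where s: "s \<in> carrier G" "f s = (1, \<lambda>i\<in>{1..k}. 0)"
      "s' \<in> carrier G" "f s' = (2, \<lambda>i\<in>{1..k}. 0)"
      using lift[of 1] lift[of 2] 1 by auto
    have pow4: "x [^]\<^bsub>G\<^esub> (4::nat) \<in> {\<one>\<^bsub>G\<^esub>, s, s'}" if x: "x \<in> carrier G" for x
    proof -
      obtain z y where fx: "f x = (z, y)"
        by (cases "f x")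
      have "4 * z mod 3 \<in> {0, 1, 2}"
        by auto
      then show ?thesis
        using s x by (auto simp: iso_pow_eq_iff[OF f] f_one fx pow_H one_H 1 intro!: restrict_ext)
    qed
    show ?thesis
      by (rule G.planar_unique_order_3_subgroup[where s = s and s' = s', OF fin])
        (use exp pow4 in auto)
  next
    case 2
    \<comment> \<open>This comes from the nonzero residue of the factor of order 2, where all cubes
      lie because they vanish modulo 3.\<close>
    obtain t where t: "t \<in> carrier G" "f t = (1, \<lambda>i\<in>{1..k}. 0)"
      using lift[of 1] 2 by auto
    have pow3: "x [^]\<^bsub>G\<^esub> (3::nat) \<in> {\<one>\<^bsub>G\<^esub>, t}" if x: "x \<in> carrier G" for x
    proof -
      obtain z y where fx: "f x = (z, y)"
        by (cases "f x")
      have "3 * z mod 2 \<in> {0, 1}"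
        by auto
      then show ?thesis
        using t x by (auto simp: iso_pow_eq_iff[OF f] f_one fx pow_H one_H 2 intro!: restrict_ext)
    qed
    show ?thesis
      by (rule G.planar_unique_involution[where t = t, OF fin]) (use exp pow3 in auto)
  qed
qed

end
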